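(* Let $G$ be a group and let $R$ be a $G$-graded ring. Then every proper graded ideal of $R$ is graded weakly total prime if and only if for every $a,b\in h(R)$ one has $\langle ab\rangle=\langle a\rangle$, $\langle ab\rangle=\langle b\rangle$, or $\langle ab\rangle=0$.
   Context: Rings are associative, not necessarily commutative and not necessarily with unity; ideals are two-sided. A ring $R$ is $G$-graded if $R=\bigoplus_{g\in G}R_g$ with additive subgroups $R_g$ satisfying $R_gR_h\subseteq R_{gh}$ for all $g,h\in G$; $h(R)=\bigcup_{g\in G}R_g$ is the set of homogeneous elements. An ideal $I$ of $R$ is graded if $I=\bigoplus_{g\in G}(I\cap R_g)$. A proper graded ideal $P$ of $R$ is graded weakly total prime if for $x,y\in h(R)$, $0\neq xy\in P$ implies $x\in P$ or $y\in P$. For $x\in R$, $\langle x\rangle=\{\sum_{i=1}^n r_ixs_i+rx+xs+mx : n\in\mathbb{N}, m\in\mathbb{Z}, r_i,s_i,r,s\in R\}$ is the two-sided ideal generated by $x$. *)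

theory Defs
  imports Main
begin

text \<open>
  Rings are types of class \<^class>\<open>ring\<close>: associative, neither a unit nor commutativity is assumed.
  The grading group is a type of class \<^class>\<open>group_add\<close>, the type class of arbitrary (not necessarily
  abelian) groups; its operation is written additively.
\<close>

definition additive_subgroup :: "'r::ab_group_add set \<Rightarrow> bool" where
  "additive_subgroup H \<longleftrightarrow>
     0 \<in> H \<and> (\<forall>x\<in>H. \<forall>y\<in>H. x + y \<in> H) \<and> (\<forall>x\<in>H. - x \<in> H)"

text \<open>
  \<open>S\<close> is the internal direct sum of the family \<open>M\<close> of additive subgroups: summation is a bijection
  from the finitely supported families with components in \<open>M g\<close> onto \<open>S\<close>.
\<close>

definition finsupp_families :: "('g \<Rightarrow> 'r::ab_group_add set) \<Rightarrow> ('g \<Rightarrow> 'r) set" where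
  "finsupp_families M = {f. (\<forall>g. f g \<in> M g) \<and> finite {g. f g \<noteq> 0}}"

definition internal_direct_sum :: "('g \<Rightarrow> 'r::ab_group_add set) \<Rightarrow> 'r set \<Rightarrow> bool" where
  "internal_direct_sum M S \<longleftrightarrow>
     (\<forall>g. additive_subgroup (M g)) \<and>
     bij_betw (\<lambda>f. \<Sum>g | f g \<noteq> 0. f g) (finsupp_families M) S"

definition graded_ring :: "('g::group_add \<Rightarrow> 'r::ring set) \<Rightarrow> bool" where
  "graded_ring R \<longleftrightarrow>
     internal_direct_sum R UNIV \<and>
     (\<forall>g h. \<forall>x\<in>R g. \<forall>y\<in>R h. x * y \<in> R (g + h))"

definition homogeneous :: "('g \<Rightarrow> 'r set) \<Rightarrow> 'r set" where
  "homogeneous R = (\<Union>g. R g)"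

definition two_sided_ideal :: "'r::ring set \<Rightarrow> bool" where
  "two_sided_ideal I \<longleftrightarrow>
     additive_subgroup I \<and> (\<forall>x\<in>I. \<forall>r. r * x \<in> I \<and> x * r \<in> I)"

definition graded_ideal :: "('g \<Rightarrow> 'r::ring set) \<Rightarrow> 'r set \<Rightarrow> bool" where
  "graded_ideal R I \<longleftrightarrow>
     two_sided_ideal I \<and> internal_direct_sum (\<lambda>g. I \<inter> R g) I"

definition proper_graded_ideal :: "('g \<Rightarrow> 'r::ring set) \<Rightarrow> 'r set \<Rightarrow> bool" where
  "proper_graded_ideal R I \<longleftrightarrow> graded_ideal R I \<and> I \<noteq> UNIV"

definition graded_weakly_total_prime :: "('g \<Rightarrow> 'r::ring set) \<Rightarrow> 'r set \<Rightarrow> bool" where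
  "graded_weakly_total_prime R P \<longleftrightarrow>
     proper_graded_ideal R P \<and>
     (\<forall>x\<in>homogeneous R. \<forall>y\<in>homogeneous R.
        0 \<noteq> x * y \<and> x * y \<in> P \<longrightarrow> x \<in> P \<or> y \<in> P)"

text \<open>
  The integer multiple \<open>m x\<close>; without a unit it cannot be written \<open>of_int m * x\<close>.
  At most one of the two sums is nonempty.
\<close>

definition int_multiple :: "int \<Rightarrow> 'r::ab_group_add \<Rightarrow> 'r" where
  "int_multiple m x = (\<Sum>i<nat m. x) - (\<Sum>i<nat (- m). x)"

definition ideal_generated :: "'r::ring \<Rightarrow> 'r set" where
  "ideal_generated x =
     {(\<Sum>i<n. r i * x * s i) + r' * x + x * s' + int_multiple m x
        | (n::nat) (m::int) (r::nat \<Rightarrow> 'r) (s::nat \<Rightarrow> 'r) (r'::'r) (s'::'r). True}"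

end

theory Submission
  imports Defs
begin

text \<open>
  For homogeneous \<open>a\<close> and \<open>b\<close> the ideal generated by \<open>a * b\<close> is graded. If it is proper and nonzero, primality puts
  \<open>a\<close> or \<open>b\<close> into it, and the generated ideals coincide; if it is everything, it contains \<open>a\<close> anyway.
  Conversely, if \<open>0 \<noteq> a * b \<in> P\<close>, then \<open>P\<close> contains the ideal generated by \<open>a * b\<close>, which is that
  of \<open>a\<close> or of \<open>b\<close>.
\<close>

subsection \<open>Generated ideals\<close>

lemma additive_subgroup_sum:
  assumes "additive_subgroup H" "\<And>i. i \<in> A \<Longrightarrow> f i \<in> H"
  shows "sum f A \<in> H"
  using assms(2) assms(1)
  by (induction A rule: infinite_finite_induct) (auto simp: additive_subgroup_def)

lemma additive_subgroup_diff:
  assumes "additive_subgroup H" "x \<in> H" "y \<in> H"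
  shows "x - y \<in> H"
  using assms unfolding additive_subgroup_def by (metis add_uminus_conv_diff)

lemma sum_const_add:
  fixes x :: "'r::ab_group_add"
  shows "(\<Sum>i<m + n. x) = (\<Sum>i<m. x) + (\<Sum>i<n::nat. x)"
  by (induction n) (simp_all add: algebra_simps)

text \<open>The truncations \<open>nat m\<close> and \<open>nat (- m)\<close> would force sign cases
  in a proof of additivity. Any way of writing the integer as a difference of naturals gives the
  same value, because common summands cancel.\<close>

lemma int_multiple_diff:
  fixes x :: "'r::ab_group_add"
  shows "int_multiple (int p - int q) x = (\<Sum>i<p. x) - (\<Sum>i<q. x)"
proof (cases "q \<le> p")
  case True
  then obtain k where "p = q + k" using le_Suc_ex by blast
  then show ?thesis by (simp add: int_multiple_def sum_const_add)
next
  case False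
  then obtain k where "q = p + k" using le_Suc_ex nat_le_linear by blast
  then show ?thesis by (simp add: int_multiple_def sum_const_add)
qed

lemma int_multiple_add: "int_multiple (m + n) x = int_multiple m x + int_multiple n x"
proof -
  obtain a b c d where m: "m = int a - int b" and n: "n = int c - int d"
    by (metis int_diff_cases)
  have mn: "m + n = int (a + c) - int (b + d)" using m n by simp
  show ?thesis
    unfolding mn int_multiple_diff unfolding m n int_multiple_diff
    by (simp add: sum_const_add algebra_simps)
qed

lemma int_multiple_minus: "int_multiple (- m) x = - int_multiple m x"
  by (simp add: int_multiple_def)

lemma int_multiple_0: "int_multiple 0 x = 0"
  and int_multiple_1: "int_multiple 1 x = x"
  by (simp_all add: int_multiple_def)

text \<open>Distributivity moves the integer multiple to the other factor. Thus a ring element times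
  an integer multiple of the generator becomes a one-sided multiple of it.\<close>

lemma mult_int_multiple:
  fixes q x :: "'r::ring"
  shows "q * int_multiple m x = int_multiple m q * x"
    and "int_multiple m x * q = x * int_multiple m q"
  by (simp_all add: int_multiple_def algebra_simps sum_distrib_left sum_distrib_right)

lemma ideal_generatedI:
  assumes "z = (\<Sum>i<n::nat. r i * x * s i) + r' * x + x * s' + int_multiple m x"
  shows "z \<in> ideal_generated x"
  using assms unfolding ideal_generated_def by blast

lemma ideal_generatedE:
  assumes "z \<in> ideal_generated x"
  obtains n r s r' s' m
  where "z = (\<Sum>i<n::nat. r i * x * s i) + r' * x + x * s' + int_multiple m x"
  using assms unfolding ideal_generated_def by blast

lemma sum_append_lessThan:
  fixes f g :: "nat \<Rightarrow> 'r::ab_group_add"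
  shows "(\<Sum>i<m + n. if i < m then f i else g (i - m)) = sum f {..<m} + sum g {..<n}"
  by (induction n) (simp_all add: algebra_simps)

lemma ideal_generated_add:
  fixes x :: "'r::ring"
  assumes "y \<in> ideal_generated x" "z \<in> ideal_generated x"
  shows "y + z \<in> ideal_generated x"
proof -
  obtain n r s r' s' m
    where y: "y = (\<Sum>i<n::nat. r i * x * s i) + r' * x + x * s' + int_multiple m x"
    using assms(1) by (rule ideal_generatedE)
  obtain k u v u' v' l
    where z: "z = (\<Sum>i<k::nat. u i * x * v i) + u' * x + x * v' + int_multiple l x"
    using assms(2) by (rule ideal_generatedE)
  \<comment> \<open>The two-sided terms of both representations are concatenated, with the second
    sequence shifted by \<open>n\<close>. Pulling the case distinction out of the product makes
    \<open>sum_append_lessThan\<close> applicable.\<close>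
  have "(\<Sum>i<n + k. (if i < n then r i else u (i - n)) * x * (if i < n then s i else v (i - n)))
      = (\<Sum>i<n + k. if i < n then r i * x * s i else u (i - n) * x * v (i - n))"
    by (rule sum.cong) auto
  also have "\<dots> = (\<Sum>i<n. r i * x * s i) + (\<Sum>i<k. u i * x * v i)"
    by (rule sum_append_lessThan)
  finally have "y + z =
      (\<Sum>i<n + k. (if i < n then r i else u (i - n)) * x * (if i < n then s i else v (i - n)))
      + (r' + u') * x + x * (s' + v') + int_multiple (m + l) x"
    by (simp add: y z int_multiple_add algebra_simps)
  then show ?thesis by (rule ideal_generatedI)
qed

lemma mult_generator_mult_in_ideal_generated: "r * x * s \<in> ideal_generated x"
  by (rule ideal_generatedI[where n = 1 and r = "\<lambda>_. r" and s = "\<lambda>_. s" and r' = 0 and s' = 0 and m = 0])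
    (simp add: int_multiple_0)

lemma mult_generator_in_ideal_generated: "r * x \<in> ideal_generated x"
  by (rule ideal_generatedI[where n = 0 and r' = r and s' = 0 and m = 0])
    (simp add: int_multiple_0)

lemma generator_mult_in_ideal_generated: "x * s \<in> ideal_generated x"
  by (rule ideal_generatedI[where n = 0 and r' = 0 and s' = s and m = 0])
    (simp add: int_multiple_0)

lemma generator_in_ideal_generated: "x \<in> ideal_generated x"
  by (rule ideal_generatedI[where n = 0 and r' = 0 and s' = 0 and m = 1])
    (simp add: int_multiple_1)

lemma additive_subgroup_ideal_generated: "additive_subgroup (ideal_generated x)"
proof -
  have "0 \<in> ideal_generated x"
    using mult_generator_in_ideal_generated[of 0] by simp
  moreover have "- z \<in> ideal_generated x" if asm: "z \<in> ideal_generated x" for z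
  proof -
    obtain n r s r' s' m
      where z: "z = (\<Sum>i<n::nat. r i * x * s i) + r' * x + x * s' + int_multiple m x"
      using asm by (rule ideal_generatedE)
    have "- z = (\<Sum>i<n. - r i * x * s i) + - r' * x + x * - s' + int_multiple (- m) x"
      by (simp add: z int_multiple_minus sum_negf)
    then show ?thesis by (rule ideal_generatedI)
  qed
  ultimately show ?thesis
    by (simp add: additive_subgroup_def ideal_generated_add)
qed

text \<open>The expanded products do not have the normal form of the definition:
  \<open>q * x * s'\<close> is an extra two-sided term. So each summand is shown to be a member
  separately, and additive closure does the rest.\<close>

lemma two_sided_ideal_ideal_generated: "two_sided_ideal (ideal_generated x)"
proof -
  have "q * z \<in> ideal_generated x \<and> z * q \<in> ideal_generated x"
    if asm: "z \<in> ideal_generated x" for z q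
  proof -
    obtain n r s r' s' m
      where z: "z = (\<Sum>i<n::nat. r i * x * s i) + r' * x + x * s' + int_multiple m x"
      using asm by (rule ideal_generatedE)
    have "q * z = (\<Sum>i<n. (q * r i) * x * s i) + (q * r') * x + q * x * s' + int_multiple m q * x"
      by (simp add: z distrib_left sum_distrib_left mult.assoc mult_int_multiple(1))
    moreover have "z * q = (\<Sum>i<n. r i * x * (s i * q)) + r' * x * q + x * (s' * q) + x * int_multiple m q"
      by (simp add: z distrib_right sum_distrib_right mult.assoc mult_int_multiple(2))
    ultimately show ?thesis
      by (simp only:)
        (intro conjI ideal_generated_add additive_subgroup_sum additive_subgroup_ideal_generated
          mult_generator_mult_in_ideal_generated mult_generator_in_ideal_generated
          generator_mult_in_ideal_generated)
  qed
  then show ?thesis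
    by (simp add: two_sided_ideal_def additive_subgroup_ideal_generated)
qed

text \<open>An ideal containing \<open>x\<close> absorbs every summand of a representation; the
  integer multiple is a difference of repeated sums of \<open>x\<close>.\<close>

lemma ideal_generated_subset:
  assumes "two_sided_ideal I" "x \<in> I"
  shows "ideal_generated x \<subseteq> I"
proof
  fix z assume "z \<in> ideal_generated x"
  then obtain n r s r' s' m
    where z: "z = (\<Sum>i<n::nat. r i * x * s i) + r' * x + x * s' + int_multiple m x"
    by (rule ideal_generatedE)
  have sub: "additive_subgroup I" and mult: "\<And>r y. y \<in> I \<Longrightarrow> r * y \<in> I" "\<And>r y. y \<in> I \<Longrightarrow> y * r \<in> I"
    using assms(1) by (auto simp: two_sided_ideal_def)
  have add: "\<And>u v. u \<in> I \<Longrightarrow> v \<in> I \<Longrightarrow> u + v \<in> I"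
    using sub by (auto simp: additive_subgroup_def)
  have "int_multiple m x \<in> I"
    unfolding int_multiple_def using sub assms(2)
    by (intro additive_subgroup_diff additive_subgroup_sum)
  then show "z \<in> I"
    unfolding z using sub assms(2) by (intro add additive_subgroup_sum mult)
qed

lemma ideal_generated_eq:
  assumes "y \<in> ideal_generated x" "x \<in> ideal_generated y"
  shows "ideal_generated x = ideal_generated y"
  using assms by (intro equalityI ideal_generated_subset two_sided_ideal_ideal_generated)

lemma ideal_generated_0: "ideal_generated 0 = {0}"
proof -
  have "two_sided_ideal {0 :: 'a::ring}"
    by (simp add: two_sided_ideal_def additive_subgroup_def)
  then show ?thesis
    using ideal_generated_subset[of "{0}" 0] generator_in_ideal_generated[of 0] by blast
qed

subsection \<open>Homogeneous components\<close>

text \<open>When the whole group is the direct sum of \<open>M\<close>, summation is bijective and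
  its inverse yields the unique homogeneous components of an element.\<close>

definition components :: "('g \<Rightarrow> 'r::ab_group_add set) \<Rightarrow> 'r \<Rightarrow> 'g \<Rightarrow> 'r" where
  "components M = inv_into (finsupp_families M) (\<lambda>f. \<Sum>g | f g \<noteq> 0. f g)"

context
  fixes M :: "'g \<Rightarrow> 'r::ab_group_add set"
  assumes direct: "internal_direct_sum M UNIV"
begin

lemma components_in_finsupp_families: "components M z \<in> finsupp_families M"
  and sum_components: "(\<Sum>g | components M z g \<noteq> 0. components M z g) = z"
proof -
  have "z \<in> (\<lambda>f. \<Sum>g | f g \<noteq> 0. f g) ` finsupp_families M"
    using direct by (simp add: internal_direct_sum_def bij_betw_def)
  from inv_into_into[OF this] f_inv_into_f[OF this]
  show "components M z \<in> finsupp_families M"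
    and "(\<Sum>g | components M z g \<noteq> 0. components M z g) = z"
    by (simp_all only: components_def)
qed

lemma components_in: "components M z g \<in> M g"
  and finite_components: "finite {g. components M z g \<noteq> 0}"
  using components_in_finsupp_families[of z] by (auto simp: finsupp_families_def)

text \<open>Injectivity of summation gives uniqueness. A finite superset \<open>A\<close> of the
  support is allowed, so the exact support need not be known.\<close>

lemma components_eqI:
  assumes "\<And>g. f g \<in> M g" "finite A" "{g. f g \<noteq> 0} \<subseteq> A" "sum f A = z"
  shows "components M z = f"
proof -
  have f: "f \<in> finsupp_families M"
    using assms finite_subset by (auto simp: finsupp_families_def)
  have "(\<Sum>g | f g \<noteq> 0. f g) = z"
    using assms by (metis (mono_tags, lifting) DiffE mem_Collect_eq sum.mono_neutral_left)
  moreover have "inj_on (\<lambda>f. \<Sum>g | f g \<noteq> 0. f g) (finsupp_families M)"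
    using direct by (auto simp: internal_direct_sum_def bij_betw_def)
  ultimately show ?thesis
    unfolding components_def using f by (auto intro: inv_into_f_eq)
qed

lemma components_add: "components M (y + z) g = components M y g + components M z g"
proof -
  \<comment> \<open>Cancellation may make the support of the sum smaller than this union, but never
    larger.\<close>
  let ?A = "{g. components M y g \<noteq> 0} \<union> {g. components M z g \<noteq> 0}"
  have fin: "finite ?A" by (simp add: finite_components)
  \<comment> \<open>Only the right-hand \<open>y\<close> is expanded, over its exact support;
    passing to \<open>?A\<close> adds zeros.\<close>
  have y: "sum (components M y) ?A = y"
    by (subst (3) sum_components[symmetric], rule sum.mono_neutral_right) (auto simp: finite_components)
  have z: "sum (components M z) ?A = z"
    by (subst (3) sum_components[symmetric], rule sum.mono_neutral_right) (auto simp: finite_components)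
  have "components M (y + z) = (\<lambda>g. components M y g + components M z g)"
  proof (rule components_eqI[where A = ?A])
    show "components M y g + components M z g \<in> M g" for g
      using direct components_in[of y g] components_in[of z g]
      by (auto simp: internal_direct_sum_def additive_subgroup_def)
    show "(\<Sum>g\<in>?A. components M y g + components M z g) = y + z"
      by (simp only: sum.distrib y z)
  qed (use fin in auto)
  then show ?thesis by simp
qed

lemma components_homogeneous:
  assumes "x \<in> M h"
  shows "components M x = (\<lambda>g. if g = h then x else 0)"
  by (rule components_eqI[where A = "{h}"])
    (use assms direct in \<open>auto simp: internal_direct_sum_def additive_subgroup_def\<close>)

lemma components_0: "components M 0 g = 0"
  using components_add[of 0 0 g] by simp

lemma components_minus: "components M (- z) g = - components M z g"
  using components_add[of z "- z" g] by (simp add: components_0 minus_unique)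

lemma components_sum: "components M (sum f A) g = (\<Sum>i\<in>A. components M (f i) g)"
  by (induction A rule: infinite_finite_induct) (simp_all add: components_0 components_add)

text \<open>Injectivity is inherited from \<open>M\<close>, and \<open>comp\<close> makes the
  component family of each element of \<open>I\<close> a preimage. Gradedness thus reduces to
  closure under components.\<close>

lemma internal_direct_sum_inter:
  assumes I: "additive_subgroup I" and comp: "\<And>z g. z \<in> I \<Longrightarrow> components M z g \<in> I"
  shows "internal_direct_sum (\<lambda>g. I \<inter> M g) I"
proof -
  let ?s = "\<lambda>f. \<Sum>g | f g \<noteq> 0. (f g :: 'r)"
  have "inj_on ?s (finsupp_families M)"
    using direct by (auto simp: internal_direct_sum_def bij_betw_def)
  then have "inj_on ?s (finsupp_families (\<lambda>g. I \<inter> M g))"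
    by (rule inj_on_subset) (auto simp: finsupp_families_def)
  moreover have "?s ` finsupp_families (\<lambda>g. I \<inter> M g) = I"
  proof
    show "?s ` finsupp_families (\<lambda>g. I \<inter> M g) \<subseteq> I"
      by (auto simp: finsupp_families_def intro!: additive_subgroup_sum[OF I])
    show "I \<subseteq> ?s ` finsupp_families (\<lambda>g. I \<inter> M g)"
    proof
      fix z assume "z \<in> I"
      then have "components M z \<in> finsupp_families (\<lambda>g. I \<inter> M g)"
        using comp components_in finite_components by (auto simp: finsupp_families_def)
      then show "z \<in> ?s ` finsupp_families (\<lambda>g. I \<inter> M g)"
        by (rule rev_image_eqI) (simp add: sum_components)
    qed
  qed
  moreover have "additive_subgroup (I \<inter> M g)" for g
    using I direct by (auto simp: internal_direct_sum_def additive_subgroup_def)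
  ultimately show ?thesis
    by (simp add: internal_direct_sum_def bij_betw_def)
qed

end

text \<open>By distributivity it suffices to treat products of components. The disjunction in
  \<open>comp\<close> serves left and right multiplication at once.\<close>

lemma components_mult_in_ideal:
  assumes R: "graded_ring R" and I: "two_sided_ideal I"
    and comp: "(\<forall>h. components R y h \<in> I) \<or> (\<forall>k. components R z k \<in> I)"
  shows "components R (y * z) g \<in> I"
proof -
  have direct: "internal_direct_sum R UNIV" and sub: "additive_subgroup I"
    using R I by (auto simp: graded_ring_def two_sided_ideal_def)
  let ?y = "components R y" and ?z = "components R z"
  have "y * z = (\<Sum>h | ?y h \<noteq> 0. \<Sum>k | ?z k \<noteq> 0. ?y h * ?z k)"
    using sum_components[OF direct, of y] sum_components[OF direct, of z]
    by (simp add: sum_product[symmetric])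
  then have eq: "components R (y * z) g =
      (\<Sum>h | ?y h \<noteq> 0. \<Sum>k | ?z k \<noteq> 0. components R (?y h * ?z k) g)"
    by (simp add: components_sum[OF direct])
  have "components R (?y h * ?z k) g \<in> I" for h k
  proof -
    \<comment> \<open>This product is homogeneous, so each of its components is the product itself
      or 0.\<close>
    have "?y h * ?z k \<in> R (h + k)"
      using R components_in[OF direct] by (auto simp: graded_ring_def)
    moreover have "?y h * ?z k \<in> I" "0 \<in> I"
      using I sub comp by (auto simp: two_sided_ideal_def additive_subgroup_def)
    ultimately show ?thesis
      by (simp add: components_homogeneous[OF direct])
  qed
  then show ?thesis
    unfolding eq by (intro additive_subgroup_sum sub)
qed

lemma graded_ideal_ideal_generated:
  assumes R: "graded_ring R" and x: "x \<in> homogeneous R"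
  shows "graded_ideal R (ideal_generated x)"
proof -
  let ?I = "ideal_generated x"
  \<comment> \<open>The largest graded ideal inside \<open>?I\<close>; it contains the generator, hence is all of \<open>?I\<close>.\<close>
  let ?J = "{z. \<forall>g. components R z g \<in> ?I}"
  have direct: "internal_direct_sum R UNIV"
    using R by (simp add: graded_ring_def)
  have I: "two_sided_ideal ?I" and sub: "additive_subgroup ?I"
    by (rule two_sided_ideal_ideal_generated additive_subgroup_ideal_generated)+
  have "additive_subgroup ?J"
    using sub by (auto simp: additive_subgroup_def components_0[OF direct]
        components_add[OF direct] components_minus[OF direct])
  \<comment> \<open>In \<open>r * z\<close> and in \<open>z * r\<close> with \<open>z\<close> in
    \<open>?J\<close>, one factor has all its components in \<open>?I\<close>.\<close>
  then have "two_sided_ideal ?J"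
    using components_mult_in_ideal[OF R I] by (auto simp: two_sided_ideal_def)
  moreover have "x \<in> ?J"
    using x sub generator_in_ideal_generated[of x]
    by (auto simp: homogeneous_def components_homogeneous[OF direct] additive_subgroup_def)
  ultimately have "?I \<subseteq> ?J"
    by (rule ideal_generated_subset)
  then have "internal_direct_sum (\<lambda>g. ?I \<inter> R g) ?I"
    by (intro internal_direct_sum_inter[OF direct sub]) auto
  then show ?thesis
    using I by (simp add: graded_ideal_def)
qed

lemma homogeneous_mult:
  assumes "graded_ring R" "a \<in> homogeneous R" "b \<in> homogeneous R"
  shows "a * b \<in> homogeneous R"
  using assms unfolding graded_ring_def homogeneous_def by blast

theorem proposition3p18:
  fixes R :: "'g::group_add \<Rightarrow> 'r::ring set"
  assumes "graded_ring R"
  shows "(\<forall>P. proper_graded_ideal R P \<longrightarrow> graded_weakly_total_prime R P) \<longleftrightarrow>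
    (\<forall>a\<in>homogeneous R. \<forall>b\<in>homogeneous R.
       ideal_generated (a * b) = ideal_generated a \<or>
       ideal_generated (a * b) = ideal_generated b \<or>
       ideal_generated (a * b) = {0})"
    (is "?L \<longleftrightarrow> ?R")
proof
  assume prime: ?L
  show ?R
  proof (intro ballI)
    fix a b assume a: "a \<in> homogeneous R" and b: "b \<in> homogeneous R"
    let ?I = "ideal_generated (a * b)"
    have graded: "graded_ideal R ?I"
      using assms a b by (intro graded_ideal_ideal_generated homogeneous_mult)
    have "a * b = 0 \<or> a \<in> ?I \<or> b \<in> ?I"
    proof (cases "?I = UNIV")
      case False
      then have "graded_weakly_total_prime R ?I"
        using prime graded by (simp add: proper_graded_ideal_def)
      then show ?thesis
        using a b generator_in_ideal_generated[of "a * b"]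
        by (auto simp: graded_weakly_total_prime_def)
    qed simp
    \<comment> \<open>Since \<open>a * b\<close> always lies in the ideals generated by
      \<open>a\<close> and by \<open>b\<close>, the membership of \<open>a\<close> or
      \<open>b\<close> in \<open>?I\<close> is all that equality requires.\<close>
    then show "?I = ideal_generated a \<or> ?I = ideal_generated b \<or> ?I = {0}"
      using ideal_generated_eq ideal_generated_0 generator_mult_in_ideal_generated
        mult_generator_in_ideal_generated by metis
  qed
next
  assume gen: ?R
  show ?L
  proof (intro allI impI)
    fix P assume P: "proper_graded_ideal R P"
    have "x \<in> P \<or> y \<in> P"
      if "x \<in> homogeneous R" "y \<in> homogeneous R" "0 \<noteq> x * y" "x * y \<in> P" for x y
    proof -
      have "ideal_generated (x * y) \<subseteq> P"
        using P that by (intro ideal_generated_subset)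
          (auto simp: proper_graded_ideal_def graded_ideal_def)
      then show ?thesis
        \<comment> \<open>The zero alternative fails because \<open>x * y\<close> is a nonzero
          member of its own ideal. Each other alternative puts \<open>x\<close> or \<open>y\<close>
          into that ideal, hence into \<open>P\<close>.\<close>
        using gen that generator_in_ideal_generated by (metis singletonD subsetD)
    qed
    then show "graded_weakly_total_prime R P"
      using P by (auto simp: graded_weakly_total_prime_def)
  qed
qed

end
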